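(* Let $(A,\circ_\lambda)$ be a commutative associative conformal algebra. There is a one-to-one correspondence between the set of equivalence classes of conformal infinitesimal deformations of $A$ and the second cohomology group $H^2_{\mathrm H}(A,A)$ (sending the class of $(A,\mu_1)$ to the cohomology class of $\mu_1$).
   Context: All vector spaces are over $\mathbb{C}$. A conformal algebra is a $\mathbb{C}[\partial]$-module $A$ with a $\mathbb{C}$-bilinear map $A\times A\to A[\lambda]$, $(a,b)\mapsto a_\lambda b$, such that $(\partial a)_\lambda b=-\lambda\, a_\lambda b$ and $a_\lambda(\partial b)=(\partial+\lambda)(a_\lambda b)$. An associative conformal algebra is a conformal algebra $(A,\circ_\lambda)$ with $a\circ_\lambda(b\circ_\mu c)=(a\circ_\lambda b)\circ_{\lambda+\mu}c$; it is commutative if $a\circ_\lambda b=b\circ_{-\lambda-\partial}a$ (with $\partial$ moved to the left, acting on coefficients). Cohomology. For $n\ge1$, $C^n_{\mathrm H}(A,A)$ is the space of $n$-$\lambda$-brackets on $A$, i.e. linear maps $\gamma:A^{\otimes n}\to\mathbb{C}[\lambda_1,\dots,\lambda_{n-1}]\otimes A$, written $a_1\otimes\cdots\otimes a_n\mapsto\{a_{1\,\lambda_1}\cdots a_{n-1\,\lambda_{n-1}}a_n\}_\gamma$, with $$\{a_{1\,\lambda_1}\cdots(\partial a_i)_{\lambda_i}\cdots a_n\}_\gamma=-\lambda_i\{a_{1\,\lambda_1}\cdots a_n\}_\gamma\ (1\le i\le n-1),\qquad \{a_{1\,\lambda_1}\cdots a_{n-1\,\lambda_{n-1}}(\partial a_n)\}_\gamma=(\lambda_1+\cdots+\lambda_{n-1}+\partial)\{a_{1\,\lambda_1}\cdots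 a_n\}_\gamma.$$ The differential $\mathrm d_{\mathrm H}:C^n_{\mathrm H}(A,A)\to C^{n+1}_{\mathrm H}(A,A)$ is $$\{a_{1\,\lambda_1}\cdots a_{n\,\lambda_n}a_{n+1}\}_{\mathrm d_{\mathrm H}\gamma}=a_1\circ_{\lambda_1}\{a_{2\,\lambda_2}\cdots a_{n\,\lambda_n}a_{n+1}\}_\gamma+\sum_{i=1}^n(-1)^i\{a_{1\,\lambda_1}\cdots(a_i\circ_{\lambda_i}a_{i+1})_{\lambda_i+\lambda_{i+1}}\cdots a_{n+1}\}_\gamma+(-1)^{n+1}\{a_{1\,\lambda_1}\cdots a_{n-1\,\lambda_{n-1}}a_n\}_\gamma\circ_{\lambda_1+\cdots+\lambda_n}a_{n+1}$$ (for $i=n$ the product $a_n\circ_{\lambda_n}a_{n+1}$ stands in the last slot, without subscript). $H^n_{\mathrm H}(A,A)$ denotes its cohomology; in particular $H^2_{\mathrm H}(A,A)=\ker(\mathrm d_{\mathrm H}|_{C^2_{\mathrm H}})/\mathrm d_{\mathrm H}(C^1_{\mathrm H})$. Deformations. A conformal infinitesimal deformation (conformal $1$-deformation) $(A,\mu_1)$ of $(A,\circ_\lambda)$ is a bilinear map $\mu_1:A\times A\to A[\lambda]$, $(a,b)\mapsto\{a_\lambda b\}_{\mu_1}$, making $A$ a conformal algebra and such that the $\mathbb{C}[[\hbar]]/\hbar^2\mathbb{C}[[\hbar]]$-bilinear operation on $A[[\hbar]]/\hbar^2A[[\hbar]]$ determined by $a\circ^\hbar_\lambda b=a\circ_\lambda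 b+\hbar\{a_\lambda b\}_{\mu_1}$ ($a,b\in A$) is an associative conformal algebra operation (not required to be commutative). Two conformal infinitesimal deformations $(A,\mu_1)$, $(A,\mu_1')$ are equivalent if there is a $\mathbb{C}[\partial]$-module homomorphism $\varphi:A\to A$ such that $\mathrm{Id}+\hbar\varphi$ is a homomorphism of conformal algebras from the first to the second modulo $\hbar^2$. *)

theory Defs
  imports
    Complex_Main
    "HOL-Library.Poly_Mapping"
    "HOL-Library.Product_Plus"
    "HOL-Computational_Algebra.Polynomial"
begin

section \<open>Polynomials with coefficients in a complex vector space\<close>

text \<open>
  A complex vector space \<open>A\<close> is a type \<^typ>\<open>'a::ab_group_add\<close> with a scalar multiplication
  \<open>s\<close> satisfying \<^locale>\<open>vector_space\<close>. The space \<open>A[\<lambda>]\<close> is \<^typ>\<open>'a poly\<close>, where multiplication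
  by \<open>\<lambda>\<close> is \<^term>\<open>pCons 0\<close>. In several variables, an element of
  \<open>\<complex>[\<lambda>\<^sub>1, \<lambda>\<^sub>2, \<dots>] \<otimes> A\<close> is a finitely supported map from monomials to \<open>A\<close>.
  The variables are numbered from 0, like list positions: \<open>\<lambda>\<^sub>1\<close> is \<open>lam 0\<close>, and so on.
\<close>

type_synonym 'a lpoly = "(nat \<Rightarrow>\<^sub>0 nat) \<Rightarrow>\<^sub>0 'a"

definition lam :: "nat \<Rightarrow> complex lpoly"
  where "lam i = Poly_Mapping.single (Poly_Mapping.single i 1) 1"

definition lconst :: "'a::zero \<Rightarrow> 'a lpoly"
  where "lconst a = Poly_Mapping.single 0 a"

text \<open>The action of \<open>\<complex>[\<lambda>\<^sub>1, \<lambda>\<^sub>2, \<dots>]\<close> on \<open>\<complex>[\<lambda>\<^sub>1, \<lambda>\<^sub>2, \<dots>] \<otimes> A\<close>.\<close>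

definition lscale :: "(complex \<Rightarrow> 'a::ab_group_add \<Rightarrow> 'a) \<Rightarrow> complex lpoly \<Rightarrow> 'a lpoly \<Rightarrow> 'a lpoly"
  where "lscale s q v =
    (\<Sum>m\<in>Poly_Mapping.keys q. \<Sum>k\<in>Poly_Mapping.keys v.
       Poly_Mapping.single (m + k) (s (Poly_Mapping.lookup q m) (Poly_Mapping.lookup v k)))"

text \<open>Substitution of \<open>q\<close> for \<open>\<lambda>\<close> in an element of \<open>A[\<lambda>]\<close>, and of \<open>\<sigma> i\<close> for each variable
  \<open>lam i\<close>.\<close>

definition subst_poly :: "(complex \<Rightarrow> 'a::ab_group_add \<Rightarrow> 'a) \<Rightarrow> complex lpoly \<Rightarrow> 'a poly \<Rightarrow> 'a lpoly"
  where "subst_poly s q p = (\<Sum>k\<le>degree p. lscale s (q ^ k) (lconst (coeff p k)))"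

definition subst_lpoly ::
    "(complex \<Rightarrow> 'a::ab_group_add \<Rightarrow> 'a) \<Rightarrow> (nat \<Rightarrow> complex lpoly) \<Rightarrow> 'a lpoly \<Rightarrow> 'a lpoly"
  where "subst_lpoly s \<sigma> v =
    (\<Sum>m\<in>Poly_Mapping.keys v.
       lscale s (\<Prod>i\<in>Poly_Mapping.keys m. \<sigma> i ^ Poly_Mapping.lookup m i)
         (lconst (Poly_Mapping.lookup v m)))"

text \<open>The product \<open>v \<circ>\<^sub>q w\<close>, extended from \<open>v, w \<in> A\<close> to polynomials \<open>v, w\<close> by
  \<open>\<complex>[\<lambda>\<^sub>1, \<lambda>\<^sub>2, \<dots>]\<close>-bilinearity.\<close>

definition prod_at :: "(complex \<Rightarrow> 'a::ab_group_add \<Rightarrow> 'a) \<Rightarrow> ('a \<Rightarrow> 'a \<Rightarrow> 'a poly)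
    \<Rightarrow> complex lpoly \<Rightarrow> 'a lpoly \<Rightarrow> 'a lpoly \<Rightarrow> 'a lpoly"
  where "prod_at s circ q v w =
    (\<Sum>m\<in>Poly_Mapping.keys v. \<Sum>k\<in>Poly_Mapping.keys w.
       lscale s (Poly_Mapping.single (m + k) 1)
         (subst_poly s q (circ (Poly_Mapping.lookup v m) (Poly_Mapping.lookup w k))))"

section \<open>Conformal algebras\<close>

locale conformal_algebra = vector_space scale
  for scale :: "complex \<Rightarrow> 'a::ab_group_add \<Rightarrow> 'a" +
  fixes D :: "'a \<Rightarrow> 'a"
    and circ :: "'a \<Rightarrow> 'a \<Rightarrow> 'a poly"
  assumes D_linear: "Vector_Spaces.linear scale scale D"
    and linear_left: "\<And>b. Vector_Spaces.linear scale (\<lambda>c. map_poly (scale c)) (\<lambda>a. circ a b)"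
    and linear_right: "\<And>a. Vector_Spaces.linear scale (\<lambda>c. map_poly (scale c)) (\<lambda>b. circ a b)"
    and D_left: "\<And>a b. circ (D a) b = - pCons 0 (circ a b)"
    and D_right: "\<And>a b. circ a (D b) = map_poly D (circ a b) + pCons 0 (circ a b)"

locale assoc_conformal_algebra = conformal_algebra scale D circ
  for scale :: "complex \<Rightarrow> 'a::ab_group_add \<Rightarrow> 'a" and D circ +
  assumes assoc: "\<And>a b c.
    prod_at scale circ (lam 0) (lconst a) (prod_at scale circ (lam 1) (lconst b) (lconst c)) =
    prod_at scale circ (lam 0 + lam 1) (prod_at scale circ (lam 0) (lconst a) (lconst b)) (lconst c)"

text \<open>The operator \<open>-\<lambda> - \<partial>\<close> on \<open>A[\<lambda>]\<close>; since \<open>\<partial>\<close> is moved to the left, \<open>b \<circ>\<^bsub>-\<lambda>-\<partial>\<^esub> a\<close> is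
  \<open>\<Sum>k. (-\<lambda> - \<partial>)\<^sup>k c\<^sub>k\<close> for \<open>b \<circ>\<^sub>\<lambda> a = \<Sum>k. \<lambda>\<^sup>k c\<^sub>k\<close>.\<close>

definition neg_lam_D :: "('a::ab_group_add \<Rightarrow> 'a) \<Rightarrow> 'a poly \<Rightarrow> 'a poly"
  where "neg_lam_D D p = - pCons 0 p - map_poly D p"

locale comm_assoc_conformal_algebra = assoc_conformal_algebra scale D circ
  for scale :: "complex \<Rightarrow> 'a::ab_group_add \<Rightarrow> 'a" and D circ +
  assumes comm: "\<And>a b.
    circ a b = (\<Sum>k\<le>degree (circ b a). (neg_lam_D D ^^ k) [:coeff (circ b a) k:])"

definition conformal_hom :: "(complex \<Rightarrow> 'a::ab_group_add \<Rightarrow> 'a) \<Rightarrow> ('a \<Rightarrow> 'a) \<Rightarrow> ('a \<Rightarrow> 'a \<Rightarrow> 'a poly)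
    \<Rightarrow> (complex \<Rightarrow> 'b::ab_group_add \<Rightarrow> 'b) \<Rightarrow> ('b \<Rightarrow> 'b) \<Rightarrow> ('b \<Rightarrow> 'b \<Rightarrow> 'b poly) \<Rightarrow> ('a \<Rightarrow> 'b) \<Rightarrow> bool"
  where "conformal_hom s D circ s' D' circ' f \<longleftrightarrow>
    Vector_Spaces.linear s s' f \<and> (\<forall>a. f (D a) = D' (f a)) \<and>
    (\<forall>a b. map_poly f (circ a b) = circ' (f a) (f b))"

section \<open>Cohomology\<close>

text \<open>
  The space of \<open>n\<close>-\<open>\<lambda>\<close>-brackets, meant for \<open>n \<ge> 1\<close>. A multilinear map of \<open>n\<close> arguments is a function on lists of
  length \<open>n\<close>; it is set to 0 on all other lists, so that equality of functions is equality of
  brackets. Values involve only the \<open>n - 1\<close> variables \<open>lam 0, \<dots>, lam (n - 2)\<close>.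
\<close>

definition brackets :: "(complex \<Rightarrow> 'a::ab_group_add \<Rightarrow> 'a) \<Rightarrow> ('a \<Rightarrow> 'a) \<Rightarrow> nat \<Rightarrow> ('a list \<Rightarrow> 'a lpoly) set"
  where "brackets s D n = {\<gamma>.
    (\<forall>xs. length xs \<noteq> n \<longrightarrow> \<gamma> xs = 0) \<and>
    (\<forall>xs. length xs = n \<longrightarrow>
      (\<forall>m\<in>Poly_Mapping.keys (\<gamma> xs). Poly_Mapping.keys m \<subseteq> {..<n - 1}) \<and>
      (\<forall>i<n. Vector_Spaces.linear s (\<lambda>c. Poly_Mapping.map (s c)) (\<lambda>a. \<gamma> (xs[i := a]))) \<and>
      (\<forall>i<n - 1. \<gamma> (xs[i := D (xs ! i)]) = - lscale s (lam i) (\<gamma> xs)) \<and>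
      \<gamma> (xs[n - 1 := D (xs ! (n - 1))]) =
        lscale s (\<Sum>i<n - 1. lam i) (\<gamma> xs) + Poly_Mapping.map D (\<gamma> xs))}"

text \<open>
  In the \<open>i\<close>-th summand of the differential (counted from 0) the entries \<open>a\<^sub>i, a\<^sub>i\<^sub>+\<^sub>1\<close> are replaced by
  \<open>a\<^sub>i \<circ> a\<^sub>i\<^sub>+\<^sub>1\<close> with \<open>\<lambda> = \<lambda>\<^sub>i\<close>, where \<open>\<gamma>\<close> is extended linearly to polynomials in \<open>\<lambda>\<^sub>i\<close>, and the
  variables of \<open>\<gamma>\<close> become \<open>\<lambda>\<^sub>0, \<dots>, \<lambda>\<^sub>i\<^sub>-\<^sub>1, \<lambda>\<^sub>i + \<lambda>\<^sub>i\<^sub>+\<^sub>1, \<lambda>\<^sub>i\<^sub>+\<^sub>2, \<dots>\<close>. For \<open>i = n - 1\<close> the product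
  stands in the last slot and only \<open>\<lambda>\<^sub>0, \<dots>, \<lambda>\<^sub>n\<^sub>-\<^sub>2\<close> occur in \<open>\<gamma>\<close>, so no sum is substituted.
\<close>

definition merge_vars :: "nat \<Rightarrow> nat \<Rightarrow> complex lpoly"
  where "merge_vars i j = (if j < i then lam j else if j = i then lam i + lam (Suc i) else lam (Suc j))"

definition hoch_d :: "(complex \<Rightarrow> 'a::ab_group_add \<Rightarrow> 'a) \<Rightarrow> ('a \<Rightarrow> 'a \<Rightarrow> 'a poly) \<Rightarrow> nat
    \<Rightarrow> ('a list \<Rightarrow> 'a lpoly) \<Rightarrow> 'a list \<Rightarrow> 'a lpoly"
  where "hoch_d s circ n \<gamma> xs =
    (if length xs \<noteq> n + 1 then 0
     else prod_at s circ (lam 0) (lconst (hd xs)) (subst_lpoly s (\<lambda>j. lam (Suc j)) (\<gamma> (tl xs)))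
       + (\<Sum>i<n. let p = circ (xs ! i) (xs ! Suc i) in
            lscale s ((- 1) ^ (i + 1))
              (\<Sum>k\<le>degree p. lscale s (lam i ^ k)
                 (subst_lpoly s (merge_vars i) (\<gamma> (take i xs @ coeff p k # drop (i + 2) xs)))))
       + lscale s ((- 1) ^ (n + 1))
           (prod_at s circ (\<Sum>i<n. lam i) (\<gamma> (butlast xs)) (lconst (last xs))))"

definition cocycles :: "(complex \<Rightarrow> 'a::ab_group_add \<Rightarrow> 'a) \<Rightarrow> ('a \<Rightarrow> 'a) \<Rightarrow> ('a \<Rightarrow> 'a \<Rightarrow> 'a poly) \<Rightarrow> nat
    \<Rightarrow> ('a list \<Rightarrow> 'a lpoly) set"
  where "cocycles s D circ n = {\<gamma> \<in> brackets s D n. hoch_d s circ n \<gamma> = (\<lambda>_. 0)}"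

text \<open>The complex starts in degree 1.\<close>

definition coboundaries :: "(complex \<Rightarrow> 'a::ab_group_add \<Rightarrow> 'a) \<Rightarrow> ('a \<Rightarrow> 'a) \<Rightarrow> ('a \<Rightarrow> 'a \<Rightarrow> 'a poly) \<Rightarrow> nat
    \<Rightarrow> ('a list \<Rightarrow> 'a lpoly) set"
  where "coboundaries s D circ n =
    (if n \<le> 1 then {\<lambda>_. 0} else hoch_d s circ (n - 1) ` brackets s D (n - 1))"

definition cohomologous :: "(complex \<Rightarrow> 'a::ab_group_add \<Rightarrow> 'a) \<Rightarrow> ('a \<Rightarrow> 'a) \<Rightarrow> ('a \<Rightarrow> 'a \<Rightarrow> 'a poly) \<Rightarrow> nat
    \<Rightarrow> (('a list \<Rightarrow> 'a lpoly) \<times> ('a list \<Rightarrow> 'a lpoly)) set"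
  where "cohomologous s D circ n =
    {(\<gamma>, \<gamma>'). \<gamma> \<in> cocycles s D circ n \<and> \<gamma>' \<in> cocycles s D circ n \<and>
       (\<lambda>xs. \<gamma> xs - \<gamma>' xs) \<in> coboundaries s D circ n}"

definition cohomology :: "(complex \<Rightarrow> 'a::ab_group_add \<Rightarrow> 'a) \<Rightarrow> ('a \<Rightarrow> 'a) \<Rightarrow> ('a \<Rightarrow> 'a \<Rightarrow> 'a poly) \<Rightarrow> nat
    \<Rightarrow> ('a list \<Rightarrow> 'a lpoly) set set"
  where "cohomology s D circ n = cocycles s D circ n // cohomologous s D circ n"

definition cohomology_class :: "(complex \<Rightarrow> 'a::ab_group_add \<Rightarrow> 'a) \<Rightarrow> ('a \<Rightarrow> 'a) \<Rightarrow> ('a \<Rightarrow> 'a \<Rightarrow> 'a poly) \<Rightarrow> nat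
    \<Rightarrow> ('a list \<Rightarrow> 'a lpoly) \<Rightarrow> ('a list \<Rightarrow> 'a lpoly) set"
  where "cohomology_class s D circ n \<gamma> = cohomologous s D circ n `` {\<gamma>}"

text \<open>A bilinear map \<open>A \<times> A \<rightarrow> A[\<lambda>]\<close> viewed as a function on lists, as in \<open>brackets\<close> for \<open>n = 2\<close>.\<close>

definition bracket_of :: "(complex \<Rightarrow> 'a::ab_group_add \<Rightarrow> 'a) \<Rightarrow> ('a \<Rightarrow> 'a \<Rightarrow> 'a poly) \<Rightarrow> 'a list \<Rightarrow> 'a lpoly"
  where "bracket_of s \<mu> xs = (if length xs = 2 then subst_poly s (lam 0) (\<mu> (xs ! 0) (xs ! 1)) else 0)"

section \<open>Infinitesimal deformations\<close>

text \<open>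
  An element \<open>a + \<hbar>b\<close> of \<open>A[[\<hbar>]]/\<hbar>\<^sup>2A[[\<hbar>]]\<close> is the pair \<open>(a, b)\<close>, so that \<open>\<hbar>(a, b) = (0, a)\<close>.
  The operation \<open>deform circ \<mu>\<close> is the \<open>\<complex>[[\<hbar>]]/\<hbar>\<^sup>2\<complex>[[\<hbar>]]\<close>-bilinear one with
  \<open>a, b \<mapsto> a \<circ>\<^sub>\<lambda> b + \<hbar>{a\<^sub>\<lambda> b}\<^sub>\<mu>\<close> for \<open>a, b \<in> A\<close>:
  \<open>(a + \<hbar>a')(b + \<hbar>b') = a \<circ>\<^sub>\<lambda> b + \<hbar>(a \<circ>\<^sub>\<lambda> b' + a' \<circ>\<^sub>\<lambda> b + {a\<^sub>\<lambda> b}\<^sub>\<mu>)\<close>.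
\<close>

definition hscale :: "(complex \<Rightarrow> 'a \<Rightarrow> 'a) \<Rightarrow> complex \<Rightarrow> 'a \<times> 'a \<Rightarrow> 'a \<times> 'a"
  where "hscale s c = map_prod (s c) (s c)"

definition hD :: "('a \<Rightarrow> 'a) \<Rightarrow> 'a \<times> 'a \<Rightarrow> 'a \<times> 'a"
  where "hD D = map_prod D D"

definition deform :: "('a::ab_group_add \<Rightarrow> 'a \<Rightarrow> 'a poly) \<Rightarrow> ('a \<Rightarrow> 'a \<Rightarrow> 'a poly)
    \<Rightarrow> 'a \<times> 'a \<Rightarrow> 'a \<times> 'a \<Rightarrow> ('a \<times> 'a) poly"
  where "deform circ \<mu> x y =
    map_poly (\<lambda>a. (a, 0)) (circ (fst x) (fst y)) +
    map_poly (\<lambda>a. (0, a)) (circ (fst x) (snd y) + circ (snd x) (fst y) + \<mu> (fst x) (fst y))"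

definition inf_deformations :: "(complex \<Rightarrow> 'a::ab_group_add \<Rightarrow> 'a) \<Rightarrow> ('a \<Rightarrow> 'a) \<Rightarrow> ('a \<Rightarrow> 'a \<Rightarrow> 'a poly)
    \<Rightarrow> ('a \<Rightarrow> 'a \<Rightarrow> 'a poly) set"
  where "inf_deformations s D circ =
    {\<mu>. conformal_algebra s D \<mu> \<and> assoc_conformal_algebra (hscale s) (hD D) (deform circ \<mu>)}"

text \<open>The map \<open>\<lambda>(a, b). (a, \<phi> a + b)\<close> is \<open>Id + \<hbar>\<phi>\<close>.\<close>

definition equiv_deformations :: "(complex \<Rightarrow> 'a::ab_group_add \<Rightarrow> 'a) \<Rightarrow> ('a \<Rightarrow> 'a) \<Rightarrow> ('a \<Rightarrow> 'a \<Rightarrow> 'a poly)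
    \<Rightarrow> (('a \<Rightarrow> 'a \<Rightarrow> 'a poly) \<times> ('a \<Rightarrow> 'a \<Rightarrow> 'a poly)) set"
  where "equiv_deformations s D circ =
    {(\<mu>, \<mu>'). \<mu> \<in> inf_deformations s D circ \<and> \<mu>' \<in> inf_deformations s D circ \<and>
       (\<exists>\<phi>. Vector_Spaces.linear s s \<phi> \<and> (\<forall>a. \<phi> (D a) = D (\<phi> a)) \<and>
          conformal_hom (hscale s) (hD D) (deform circ \<mu>) (hscale s) (hD D) (deform circ \<mu>')
            (\<lambda>(a, b). (a, \<phi> a + b)))}"

end

theory Submission
  imports Defs
begin

text \<open>
  The product of a deformation is \<open>\<circ> + \<hbar>\<mu>\<close>. The associator of a product is linear in its outer
  and in its inner multiplication, so modulo \<open>\<hbar>\<^sup>2\<close> the associator of \<open>\<circ> + \<hbar>\<mu>\<close> is that of \<open>\<circ>\<close>,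
  which vanishes, plus \<open>\<hbar>\<close> times the mixed terms with one \<open>\<circ>\<close> and one \<open>\<mu>\<close>. These mixed terms are
  the Hochschild differential of \<open>\<mu>\<close> (\<open>hoch_d_2_bracket_of\<close>), and the conformal algebra axioms for
  \<open>\<mu>\<close> say that \<open>\<mu>\<close> is a bracket of two arguments (\<open>bracket_of_in_brackets_iff\<close>). Infinitesimal
  deformations are therefore the same thing as 2-cocycles (\<open>bij_betw_deformations_cocycles\<close>).

  In the same way, comparing the coefficients of \<open>\<hbar>\<close> in the condition that \<open>Id + \<hbar>\<phi>\<close> carries
  \<open>\<circ> + \<hbar>\<mu>\<close> to \<open>\<circ> + \<hbar>\<mu>'\<close> gives
  \<open>\<mu>(a, b) - \<mu>'(a, b) = a \<circ> \<phi>(b) - \<phi>(a \<circ> b) + \<phi>(a) \<circ> b\<close>, and the right-hand side is the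
  differential of the bracket \<open>\<phi>\<close> of one argument. So the bijection carries equivalence of
  deformations to the relation of being cohomologous, in both directions
  (\<open>equiv_deformations_iff_cohomologous\<close>), and taking images of classes is the required
  correspondence.

  What takes work is the passage between \<open>A[\<lambda>]\<close>, where the products live, and
  \<open>\<complex>[\<lambda>\<^sub>0, \<lambda>\<^sub>1, \<dots>] \<otimes> A\<close>, where the brackets live. The link is the substitution \<open>\<lambda> \<mapsto> \<lambda>\<^sub>0\<close>, which
  identifies \<open>A[\<lambda>]\<close> with the elements that involve \<open>\<lambda>\<^sub>0\<close> only and turns every operation used here
  into its counterpart. The coefficients of 1 and \<open>\<hbar>\<close> are read off with the linear maps
  \<^const>\<open>fst\<close> and \<^const>\<open>snd\<close>, with which scalar multiplication and substitution commute.
\<close>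

section \<open>Coefficientwise maps\<close>

lemma lookup_map_zero:
  "f 0 = 0 \<Longrightarrow> Poly_Mapping.lookup (Poly_Mapping.map f v) m = f (Poly_Mapping.lookup v m)"
  by (simp add: Poly_Mapping.map.rep_eq when_def)

lemma additive_lpoly_map: "additive h \<Longrightarrow> additive (Poly_Mapping.map h)"
  by (auto simp: additive_def additive.zero lookup_map_zero lookup_add intro!: poly_mapping_eqI)

lemma lpoly_sum_monomials:
  "(\<Sum>m\<in>Poly_Mapping.keys v. Poly_Mapping.single m (Poly_Mapping.lookup v m)) = (v :: 'a::ab_group_add lpoly)"
proof (rule poly_mapping_eqI)
  fix k
  have "(\<Sum>m\<in>Poly_Mapping.keys v. Poly_Mapping.lookup v m when m = k) = Poly_Mapping.lookup v k"
    by (cases "k \<in> Poly_Mapping.keys v") (auto simp: when_def in_keys_iff)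
  then show "Poly_Mapping.lookup (\<Sum>m\<in>Poly_Mapping.keys v. Poly_Mapping.single m (Poly_Mapping.lookup v m)) k
      = Poly_Mapping.lookup v k"
    by (simp add: lookup_sum lookup_single)
qed

lemma linear_additive: "Vector_Spaces.linear s1 s2 f \<Longrightarrow> additive f"
  by (simp add: Vector_Spaces.linear_iff additive_def)

lemma linear_zero: "Vector_Spaces.linear s1 s2 f \<Longrightarrow> f 0 = 0"
  by (rule additive.zero[OF linear_additive])

lemma vector_space_map_poly:
  assumes "vector_space (s :: complex \<Rightarrow> 'a::ab_group_add \<Rightarrow> 'a)"
  shows "vector_space (\<lambda>c. map_poly (s c))"
proof -
  interpret vector_space s by fact
  show ?thesis
    by unfold_locales (auto intro!: poly_eqI simp: coeff_map_poly algebra_simps)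
qed

lemma vector_space_map_lpoly:
  assumes "vector_space (s :: complex \<Rightarrow> 'a::ab_group_add \<Rightarrow> 'a)"
  shows "vector_space (\<lambda>c. Poly_Mapping.map (s c) :: 'a lpoly \<Rightarrow> 'a lpoly)"
proof -
  interpret vector_space s by fact
  show ?thesis
    by unfold_locales (auto intro!: poly_mapping_eqI simp: lookup_map_zero lookup_add algebra_simps)
qed

lemma lconst_0 [simp]: "lconst 0 = 0"
  by (simp add: lconst_def)

lemma lam_power: "lam i ^ k = Poly_Mapping.single (Poly_Mapping.single i k) 1"
proof (induction k)
  case (Suc k)
  then show ?case
    by (simp add: lam_def mult_single single_add[symmetric])
qed simp

section \<open>Calculus of polynomials with vector coefficients\<close>

locale complex_vector_space = vector_space s
  for s :: "complex \<Rightarrow> 'a::ab_group_add \<Rightarrow> 'a"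
begin

text \<open>The sums in the definitions range over supports, which change under addition and under linear
  maps. Extending them to a fixed larger finite set, where the new summands vanish, makes additivity
  and naturality termwise statements. The same device is used for \<^const>\<open>subst_poly\<close> (with a degree
  bound) and for \<^const>\<open>prod_at\<close>.\<close>

lemma lscale_superset:
  assumes "finite K" "finite L" "Poly_Mapping.keys q \<subseteq> K" "Poly_Mapping.keys v \<subseteq> L"
  shows "lscale s q v = (\<Sum>m\<in>K. \<Sum>k\<in>L.
    Poly_Mapping.single (m + k) (s (Poly_Mapping.lookup q m) (Poly_Mapping.lookup v k)))"
proof -
  have "(\<Sum>k\<in>Poly_Mapping.keys v. Poly_Mapping.single (m + k) (s (Poly_Mapping.lookup q m) (Poly_Mapping.lookup v k)))
      = (\<Sum>k\<in>L. Poly_Mapping.single (m + k) (s (Poly_Mapping.lookup q m) (Poly_Mapping.lookup v k)))" for m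
    using assms by (intro sum.mono_neutral_left) (auto simp: in_keys_iff)
  then show ?thesis
    unfolding lscale_def using assms
    by (simp, intro sum.mono_neutral_left) (auto simp: in_keys_iff)
qed

lemma additive_lscale: "additive (lscale s q)"
proof
  fix v w :: "'a lpoly"
  let ?L = "Poly_Mapping.keys v \<union> Poly_Mapping.keys w"
  have "lscale s q u = (\<Sum>m\<in>Poly_Mapping.keys q. \<Sum>k\<in>?L.
      Poly_Mapping.single (m + k) (s (Poly_Mapping.lookup q m) (Poly_Mapping.lookup u k)))"
    if "Poly_Mapping.keys u \<subseteq> ?L" for u
    using that by (intro lscale_superset) auto
  from this[of v] this[of w] this[of "v + w"] show "lscale s q (v + w) = lscale s q v + lscale s q w"
    using keys_add[of v w]
    by (simp add: lookup_add algebra_simps single_add sum.distrib)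
qed

lemmas lscale_add = additive.add[OF additive_lscale]
lemmas lscale_zero [simp] = additive.zero[OF additive_lscale]
lemmas lscale_sum = additive.sum[OF additive_lscale]

lemma lscale_zero_left [simp]: "lscale s 0 v = 0"
  by (simp add: lscale_def)

lemma lscale_single:
  "lscale s (Poly_Mapping.single m c) (Poly_Mapping.single k a) = Poly_Mapping.single (m + k) (s c a)"
  by (subst lscale_superset[where K = "{m}" and L = "{k}"]) (auto split: if_splits)

lemma lscale_one [simp]: "lscale s 1 v = v"
  by (subst lscale_superset[where K = "{0}" and L = "Poly_Mapping.keys v"])
    (auto simp: lpoly_sum_monomials)

lemma lscale_minus_one [simp]: "lscale s (- 1) v = - v"
  by (subst lscale_superset[where K = "{0}" and L = "Poly_Mapping.keys v"])
    (auto simp: lpoly_sum_monomials single_uminus sum_negf in_keys_iff)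

lemma lscale_map:
  assumes h: "Vector_Spaces.linear s s' h"
  shows "Poly_Mapping.map h (lscale s q v) = lscale s' q (Poly_Mapping.map h v)"
proof -
  have s': "complex_vector_space s'"
    using h by (simp add: Vector_Spaces.linear_iff complex_vector_space_def)
  note h0 = linear_zero[OF h]
  have "lscale s' q (Poly_Mapping.map h v) = (\<Sum>m\<in>Poly_Mapping.keys q. \<Sum>k\<in>Poly_Mapping.keys v.
      Poly_Mapping.single (m + k) (s' (Poly_Mapping.lookup q m) (h (Poly_Mapping.lookup v k))))"
    by (subst complex_vector_space.lscale_superset[OF s', where K = "Poly_Mapping.keys q" and L = "Poly_Mapping.keys v"])
      (auto simp: in_keys_iff lookup_map_zero h0)
  moreover have "h (s c a) = s' c (h a)" for c a
    using h by (simp add: Vector_Spaces.linear_iff)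
  ultimately show ?thesis
    by (simp add: lscale_def additive.sum[OF additive_lpoly_map[OF linear_additive[OF h]]] map_single h0)
qed

lemma subst_poly_superset:
  assumes "degree p \<le> N"
  shows "subst_poly s q p = (\<Sum>k\<le>N. lscale s (q ^ k) (lconst (coeff p k)))"
  unfolding subst_poly_def using assms
  by (intro sum.mono_neutral_left) (auto simp: coeff_eq_0)

lemma additive_subst_poly: "additive (subst_poly s q)"
proof
  fix p r :: "'a poly"
  let ?N = "max (degree p) (degree r)"
  have "subst_poly s q u = (\<Sum>k\<le>?N. lscale s (q ^ k) (lconst (coeff u k)))" if "degree u \<le> ?N" for u
    using that by (rule subst_poly_superset)
  from this[of p] this[of r] this[of "p + r"]
  show "subst_poly s q (p + r) = subst_poly s q p + subst_poly s q r"
    by (simp add: degree_add_le lconst_def single_add lscale_add sum.distrib)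
qed

lemmas subst_poly_add = additive.add[OF additive_subst_poly]
lemmas subst_poly_zero [simp] = additive.zero[OF additive_subst_poly]

lemma subst_poly_map:
  assumes h: "Vector_Spaces.linear s s' h"
  shows "Poly_Mapping.map h (subst_poly s q p) = subst_poly s' q (map_poly h p)"
proof -
  have s': "complex_vector_space s'"
    using h by (simp add: Vector_Spaces.linear_iff complex_vector_space_def)
  note h0 = linear_zero[OF h]
  have "degree (map_poly h p) \<le> degree p"
    by (rule degree_le) (simp add: coeff_map_poly h0 coeff_eq_0)
  then show ?thesis
    by (simp add: complex_vector_space.subst_poly_superset[OF s', of _ "degree p"] subst_poly_def[of s]
        additive.sum[OF additive_lpoly_map[OF linear_additive[OF h]]] lscale_map[OF h]
        lconst_def map_single coeff_map_poly h0)
qed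

lemma subst_poly_const [simp]: "subst_poly s q [:a:] = lconst a"
  by (simp add: subst_poly_def)

lemma subst_poly_lam:
  "subst_poly s (lam i) p =
    (\<Sum>k\<le>degree p. Poly_Mapping.single (Poly_Mapping.single i k) (coeff p k))"
  by (simp add: subst_poly_def lam_power lconst_def lscale_single)

text \<open>Distinct powers of \<open>\<lambda>\<close> go to distinct monomials, so the substitution of a single variable loses
  no information; this is what makes \<open>A[\<lambda>]\<close> a subspace of the space of values of brackets.\<close>

lemma lookup_subst_poly_lam:
  "Poly_Mapping.lookup (subst_poly s (lam i) p) (Poly_Mapping.single i k) = coeff p k"
  by (auto simp: subst_poly_lam lookup_sum lookup_single when_def coeff_eq_0 inj_eq[OF inj_single])

lemma inj_subst_poly_lam: "inj (subst_poly s (lam i))"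
  by (rule injI) (metis lookup_subst_poly_lam poly_eqI)

lemma keys_subst_poly_lam:
  "Poly_Mapping.keys (subst_poly s (lam i) p) \<subseteq> Poly_Mapping.single i ` {..degree p}"
proof
  fix m assume "m \<in> Poly_Mapping.keys (subst_poly s (lam i) p)"
  then have "(\<Sum>k\<le>degree p. coeff p k when Poly_Mapping.single i k = m) \<noteq> 0"
    by (simp add: in_keys_iff subst_poly_lam lookup_sum lookup_single)
  then obtain k where "k \<le> degree p" "(coeff p k when Poly_Mapping.single i k = m) \<noteq> 0"
    by (metis (mono_tags, lifting) atMost_iff sum.neutral)
  then show "m \<in> Poly_Mapping.single i ` {..degree p}"
    by auto
qed

lemma subst_poly_lam_monom:
  "subst_poly s (lam i) (monom a k) = Poly_Mapping.single (Poly_Mapping.single i k) a"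
proof -
  have "subst_poly s (lam i) (monom a k)
      = (\<Sum>j\<le>k. Poly_Mapping.single (Poly_Mapping.single i j) (coeff (monom a k) j))"
    by (subst subst_poly_superset[OF degree_monom_le])
      (simp add: lam_power lconst_def lscale_single)
  also have "\<dots> = (\<Sum>j\<in>{k}. Poly_Mapping.single (Poly_Mapping.single i j) (coeff (monom a k) j))"
    by (rule sum.mono_neutral_right) auto
  finally show ?thesis by simp
qed

lemma univariate_lpoly_is_subst:
  assumes "\<forall>m\<in>Poly_Mapping.keys v. Poly_Mapping.keys m \<subseteq> {i}"
  shows "\<exists>p. subst_poly s (lam i) p = v"
proof
  have "Poly_Mapping.single i (Poly_Mapping.lookup m i) = m" if "m \<in> Poly_Mapping.keys v" for m
    using assms that by (intro poly_mapping_eqI) (force simp: lookup_single when_def in_keys_iff)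
  then show "subst_poly s (lam i) (\<Sum>m\<in>Poly_Mapping.keys v. monom (Poly_Mapping.lookup v m) (Poly_Mapping.lookup m i)) = v"
    by (simp add: additive.sum[OF additive_subst_poly] subst_poly_lam_monom lpoly_sum_monomials)
qed

lemma subst_poly_lam_shift:
  "subst_poly s (lam i) (pCons 0 p) = lscale s (lam i) (subst_poly s (lam i) p)"
proof -
  have "subst_poly s (lam i) (pCons 0 p) = (\<Sum>k\<le>Suc (degree p).
      Poly_Mapping.single (Poly_Mapping.single i k) (coeff (pCons 0 p) k))"
    by (subst subst_poly_superset[OF degree_pCons_le])
      (simp add: lam_power lconst_def lscale_single)
  also have "\<dots> = (\<Sum>k\<le>degree p. Poly_Mapping.single (Poly_Mapping.single i (Suc k)) (coeff p k))"
    by (subst sum.atMost_Suc_shift) simp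
  also have "\<dots> = lscale s (lam i) (subst_poly s (lam i) p)"
    unfolding subst_poly_lam lscale_sum
    by (simp add: lam_def lscale_single single_add[symmetric])
  finally show ?thesis .
qed

text \<open>A bracket that comes from a product on \<open>A\<close> has values in the variable \<open>\<lambda>\<^sub>0\<close>. The changes of
  variables in the Hochschild differential then reduce to evaluating the product at the polynomial
  substituted for \<open>\<lambda>\<^sub>0\<close>.\<close>

lemma subst_lpoly_subst_poly:
  "subst_lpoly s \<sigma> (subst_poly s (lam 0) p) = subst_poly s (\<sigma> 0) p"
proof -
  let ?v = "subst_poly s (lam 0) p"
  let ?g = "\<lambda>m. lscale s (\<Prod>i\<in>Poly_Mapping.keys m. \<sigma> i ^ Poly_Mapping.lookup m i)
      (lconst (Poly_Mapping.lookup ?v m))"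
  have "subst_lpoly s \<sigma> ?v = (\<Sum>m\<in>Poly_Mapping.single 0 ` {..degree p}. ?g m)"
    unfolding subst_lpoly_def using keys_subst_poly_lam[of 0 p]
    by (intro sum.mono_neutral_left) (auto simp: in_keys_iff)
  also have "\<dots> = (\<Sum>k\<le>degree p. ?g (Poly_Mapping.single 0 k))"
    by (subst sum.reindex) (auto simp: inj_on_def inj_eq[OF inj_single])
  also have "\<dots> = subst_poly s (\<sigma> 0) p"
    unfolding subst_poly_def[of s "\<sigma> 0"]
    by (intro sum.cong) (auto simp: lookup_subst_poly_lam lookup_subst_poly_lam[of 0 p 0, simplified])
  finally show ?thesis .
qed

lemma subst_lpoly_lconst: "subst_lpoly s \<sigma> (lconst a) = lconst a"
  using subst_lpoly_subst_poly[of \<sigma> "[:a:]"] by simp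

end

sublocale conformal_algebra \<subseteq> complex_vector_space scale ..

section \<open>Products at a polynomial argument\<close>

context conformal_algebra
begin

lemma circ_zero [simp]: "circ 0 b = 0" "circ a 0 = 0"
  using linear_zero[OF linear_left] linear_zero[OF linear_right] by auto

lemma circ_add: "circ (a + a') b = circ a b + circ a' b" "circ a (b + b') = circ a b + circ a b'"
  using additive.add[OF linear_additive[OF linear_left]]
    additive.add[OF linear_additive[OF linear_right]] by auto

lemma prod_at_superset:
  assumes "finite K" "finite L" "Poly_Mapping.keys v \<subseteq> K" "Poly_Mapping.keys w \<subseteq> L"
  shows "prod_at scale circ q v w = (\<Sum>m\<in>K. \<Sum>k\<in>L. lscale scale (Poly_Mapping.single (m + k) 1)
    (subst_poly scale q (circ (Poly_Mapping.lookup v m) (Poly_Mapping.lookup w k))))"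
proof -
  have "(\<Sum>k\<in>Poly_Mapping.keys w. lscale scale (Poly_Mapping.single (m + k) 1)
      (subst_poly scale q (circ (Poly_Mapping.lookup v m) (Poly_Mapping.lookup w k))))
      = (\<Sum>k\<in>L. lscale scale (Poly_Mapping.single (m + k) 1)
      (subst_poly scale q (circ (Poly_Mapping.lookup v m) (Poly_Mapping.lookup w k))))" for m
    using assms by (intro sum.mono_neutral_left) (auto simp: in_keys_iff)
  then show ?thesis
    unfolding prod_at_def using assms
    by (simp, intro sum.mono_neutral_left) (auto simp: in_keys_iff)
qed

lemma prod_at_add_right: "prod_at scale circ q v (w + w') = prod_at scale circ q v w + prod_at scale circ q v w'"
proof -
  let ?L = "Poly_Mapping.keys w \<union> Poly_Mapping.keys w'"
  note eq = prod_at_superset[where K = "Poly_Mapping.keys v" and L = ?L, OF _ _ subset_refl]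
  show ?thesis
    using eq[of w q] eq[of w' q] eq[of "w + w'" q] keys_add[of w w']
    by (simp add: lookup_add circ_add subst_poly_add lscale_add sum.distrib)
qed

lemma prod_at_add_left: "prod_at scale circ q (v + v') w = prod_at scale circ q v w + prod_at scale circ q v' w"
proof -
  let ?K = "Poly_Mapping.keys v \<union> Poly_Mapping.keys v'"
  note eq = prod_at_superset[where K = ?K and L = "Poly_Mapping.keys w", OF _ _ _ subset_refl]
  show ?thesis
    using eq[of v q] eq[of v' q] eq[of "v + v'" q] keys_add[of v v']
    by (simp add: lookup_add circ_add subst_poly_add lscale_add sum.distrib)
qed

lemma prod_at_single:
  "prod_at scale circ q (Poly_Mapping.single m a) (Poly_Mapping.single k b) =
    lscale scale (Poly_Mapping.single (m + k) 1) (subst_poly scale q (circ a b))"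
  by (subst prod_at_superset[where K = "{m}" and L = "{k}"]) auto

lemma prod_at_lconst:
  "prod_at scale circ q (lconst a) (lconst b) = subst_poly scale q (circ a b)"
  by (simp add: lconst_def prod_at_single)

text \<open>This and the next lemma recognise the inner summands of the Hochschild differential, which insert
  the coefficients of \<open>a\<^sub>i \<circ> a\<^sub>i\<^sub>+\<^sub>1\<close> one at a time, as products with a polynomial argument.\<close>

lemma prod_at_lconst_subst:
  "prod_at scale circ q (lconst a) (subst_poly scale (lam i) p) =
    (\<Sum>k\<le>degree p. lscale scale (lam i ^ k) (subst_poly scale q (circ a (coeff p k))))"
proof -
  have "additive (prod_at scale circ q (lconst a))"
    by standard (rule prod_at_add_right)
  note sum = additive.sum[OF this]
  show ?thesis
    by (simp add: subst_poly_lam sum) (simp add: lconst_def prod_at_single lam_power)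
qed

lemma prod_at_subst_lconst:
  "prod_at scale circ q (subst_poly scale (lam i) p) (lconst b) =
    (\<Sum>k\<le>degree p. lscale scale (lam i ^ k) (subst_poly scale q (circ (coeff p k) b)))"
proof -
  have "additive (\<lambda>v. prod_at scale circ q v (lconst b))"
    by standard (rule prod_at_add_left)
  note sum = additive.sum[OF this]
  show ?thesis
    by (simp add: subst_poly_lam sum) (simp add: lconst_def prod_at_single lam_power)
qed

text \<open>This and the next lemma bring the product of projected arguments and the projection of a product
  to sums over the same index sets, so that they can be compared term by term.\<close>

lemma prod_at_map_args:
  assumes "f 0 = 0" "g 0 = 0"
  shows "prod_at scale circ q (Poly_Mapping.map f v) (Poly_Mapping.map g w) =
    (\<Sum>m\<in>Poly_Mapping.keys v. \<Sum>k\<in>Poly_Mapping.keys w. lscale scale (Poly_Mapping.single (m + k) 1)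
      (subst_poly scale q (circ (f (Poly_Mapping.lookup v m)) (g (Poly_Mapping.lookup w k)))))"
  using assms
  by (subst prod_at_superset[where K = "Poly_Mapping.keys v" and L = "Poly_Mapping.keys w"])
    (auto simp: in_keys_iff lookup_map_zero)

lemma prod_at_map_result:
  assumes h: "Vector_Spaces.linear scale s' h"
  shows "Poly_Mapping.map h (prod_at scale circ q v w) =
    (\<Sum>m\<in>Poly_Mapping.keys v. \<Sum>k\<in>Poly_Mapping.keys w. lscale s' (Poly_Mapping.single (m + k) 1)
      (subst_poly s' q (map_poly h (circ (Poly_Mapping.lookup v m) (Poly_Mapping.lookup w k)))))"
  by (simp add: prod_at_def additive.sum[OF additive_lpoly_map[OF linear_additive[OF h]]]
      lscale_map[OF h] subst_poly_map[OF h])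

end

section \<open>The associator and its linearisation\<close>

text \<open>The outer and the inner multiplication are kept separate, because the associator is linear in each
  of them and its linearisation is needed below.\<close>

definition associator :: "(complex \<Rightarrow> 'a::ab_group_add \<Rightarrow> 'a) \<Rightarrow> ('a \<Rightarrow> 'a \<Rightarrow> 'a poly)
    \<Rightarrow> ('a \<Rightarrow> 'a \<Rightarrow> 'a poly) \<Rightarrow> 'a \<Rightarrow> 'a \<Rightarrow> 'a \<Rightarrow> 'a lpoly"
  where "associator s circ1 circ2 a b c =
    prod_at s circ1 (lam 0) (lconst a) (prod_at s circ2 (lam 1) (lconst b) (lconst c)) -
    prod_at s circ1 (lam 0 + lam 1) (prod_at s circ2 (lam 0) (lconst a) (lconst b)) (lconst c)"

lemma assoc_conformal_algebra_iff_associator: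
  "assoc_conformal_algebra s D circ \<longleftrightarrow>
    conformal_algebra s D circ \<and> (\<forall>a b c. associator s circ circ a b c = 0)"
  by (simp add: assoc_conformal_algebra_def assoc_conformal_algebra_axioms_def associator_def)

lemma coeff_deform:
  "coeff (deform circ \<mu> x y) n = (coeff (circ (fst x) (fst y)) n,
    coeff (circ (fst x) (snd y)) n + coeff (circ (snd x) (fst y)) n + coeff (\<mu> (fst x) (fst y)) n)"
  by (simp add: deform_def coeff_map_poly zero_prod_def)

lemma map_poly_deform:
  "map_poly fst (deform circ \<mu> x y) = circ (fst x) (fst y)"
  "map_poly snd (deform circ \<mu> x y) = circ (fst x) (snd y) + circ (snd x) (fst y) + \<mu> (fst x) (fst y)"
  by (auto intro!: poly_eqI simp: coeff_map_poly coeff_deform)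

lemma vector_space_hscale:
  assumes "vector_space s"
  shows "vector_space (hscale s)"
proof -
  interpret vector_space s by fact
  show ?thesis
    by unfold_locales (auto simp: hscale_def algebra_simps)
qed

lemma linear_fst_hscale: "vector_space s \<Longrightarrow> Vector_Spaces.linear (hscale s) s fst"
  and linear_snd_hscale: "vector_space s \<Longrightarrow> Vector_Spaces.linear (hscale s) s snd"
  by (simp_all add: Vector_Spaces.linear_iff vector_space_hscale hscale_def)

locale conformal_algebra_pair = conformal_algebra scale D circ + mu: conformal_algebra scale D \<mu>
  for scale :: "complex \<Rightarrow> 'a::ab_group_add \<Rightarrow> 'a" and D circ \<mu>
begin

lemma conformal_algebra_deform: "conformal_algebra (hscale scale) (hD D) (deform circ \<mu>)"
proof -
  note vs = vector_space_hscale[OF vector_space_axioms]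
  note D_simps = linear_zero[OF D_linear] D_linear[unfolded Vector_Spaces.linear_iff]
  have scales: "circ (scale c a) b = map_poly (scale c) (circ a b)" "circ a (scale c b) = map_poly (scale c) (circ a b)"
    "\<mu> (scale c a) b = map_poly (scale c) (\<mu> a b)" "\<mu> a (scale c b) = map_poly (scale c) (\<mu> a b)" for c a b
    using linear_left linear_right mu.linear_left mu.linear_right
    by (simp_all add: Vector_Spaces.linear_iff)
  show ?thesis
  proof (intro conformal_algebra.intro conformal_algebra_axioms.intro vs)
    show "Vector_Spaces.linear (hscale scale) (hscale scale) (hD D)"
      using D_linear vs by (auto simp: Vector_Spaces.linear_iff hscale_def hD_def)
    show "Vector_Spaces.linear (hscale scale) (\<lambda>c. map_poly (hscale scale c)) (\<lambda>a. deform circ \<mu> a b)" for b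
      using vs vector_space_map_poly[OF vs]
      by (auto simp: Vector_Spaces.linear_iff hscale_def coeff_deform coeff_map_poly circ_add mu.circ_add
          scales algebra_simps zero_prod_def intro!: poly_eqI)
    show "Vector_Spaces.linear (hscale scale) (\<lambda>c. map_poly (hscale scale c)) (deform circ \<mu> a)" for a
      using vs vector_space_map_poly[OF vs]
      by (auto simp: Vector_Spaces.linear_iff hscale_def coeff_deform coeff_map_poly circ_add mu.circ_add
          scales algebra_simps zero_prod_def intro!: poly_eqI)
    show "deform circ \<mu> (hD D a) b = - pCons 0 (deform circ \<mu> a b)" for a b
      by (auto simp: hD_def coeff_deform coeff_pCons D_left mu.D_left zero_prod_def
          intro!: poly_eqI split: nat.splits)
    show "deform circ \<mu> a (hD D b) = map_poly (hD D) (deform circ \<mu> a b) + pCons 0 (deform circ \<mu> a b)" for a b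
      by (auto simp: hD_def coeff_deform coeff_pCons D_right mu.D_right coeff_map_poly D_simps zero_prod_def
          intro!: poly_eqI split: nat.splits)
  qed
qed

text \<open>The two components of the deformed product, extended to polynomials: the \<open>\<hbar>\<close>-part is the Leibniz
  rule for \<open>\<circ>\<close> with the correction \<open>\<mu>\<close>.\<close>

lemma map_prod_at_deform:
  "Poly_Mapping.map fst (prod_at (hscale scale) (deform circ \<mu>) q v w) =
    prod_at scale circ q (Poly_Mapping.map fst v) (Poly_Mapping.map fst w)"
  "Poly_Mapping.map snd (prod_at (hscale scale) (deform circ \<mu>) q v w) =
    prod_at scale circ q (Poly_Mapping.map fst v) (Poly_Mapping.map snd w) +
    prod_at scale circ q (Poly_Mapping.map snd v) (Poly_Mapping.map fst w) +
    prod_at scale \<mu> q (Poly_Mapping.map fst v) (Poly_Mapping.map fst w)"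
  using conformal_algebra.prod_at_map_result[OF conformal_algebra_deform linear_fst_hscale[OF vector_space_axioms]]
    conformal_algebra.prod_at_map_result[OF conformal_algebra_deform linear_snd_hscale[OF vector_space_axioms]]
  by (simp_all add: map_poly_deform prod_at_map_args mu.prod_at_map_args subst_poly_add lscale_add sum.distrib)

text \<open>Expanding the \<open>\<hbar>\<close>-part of a double product by the previous lemma, each summand has exactly one
  factor \<open>\<hbar>\<close>: it is carried by one of the three arguments, by the inner multiplication or by the
  outer one.\<close>

lemma associator_deform:
  fixes a b c :: "'a \<times> 'a"
  defines "assoc_h \<equiv> associator (hscale scale) (deform circ \<mu>) (deform circ \<mu>) a b c"
  shows "Poly_Mapping.map fst assoc_h = associator scale circ circ (fst a) (fst b) (fst c)"
    and "Poly_Mapping.map snd assoc_h =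
      associator scale circ circ (fst a) (fst b) (snd c) +
      associator scale circ circ (fst a) (snd b) (fst c) +
      associator scale circ circ (snd a) (fst b) (fst c) +
      (associator scale circ \<mu> (fst a) (fst b) (fst c) + associator scale \<mu> circ (fst a) (fst b) (fst c))"
proof -
  have diff: "Poly_Mapping.map fst (v - w) = Poly_Mapping.map fst v - Poly_Mapping.map fst w"
    "Poly_Mapping.map snd (v - w) = Poly_Mapping.map snd v - Poly_Mapping.map snd w" for v w :: "('a \<times> 'a) lpoly"
    by (auto intro!: poly_mapping_eqI simp: lookup_map_zero lookup_minus)
  have const: "Poly_Mapping.map fst (lconst x) = lconst (fst x)" "Poly_Mapping.map snd (lconst x) = lconst (snd x)"
    for x :: "'a \<times> 'a"
    by (simp_all add: lconst_def map_single)
  show "Poly_Mapping.map fst assoc_h = associator scale circ circ (fst a) (fst b) (fst c)"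
    by (simp add: assoc_h_def associator_def diff map_prod_at_deform const)
  show "Poly_Mapping.map snd assoc_h =
      associator scale circ circ (fst a) (fst b) (snd c) +
      associator scale circ circ (fst a) (snd b) (fst c) +
      associator scale circ circ (snd a) (fst b) (fst c) +
      (associator scale circ \<mu> (fst a) (fst b) (fst c) + associator scale \<mu> circ (fst a) (fst b) (fst c))"
    by (simp add: assoc_h_def associator_def diff map_prod_at_deform const
        prod_at_add_left prod_at_add_right)
qed

text \<open>Associativity of \<open>\<circ>\<close> kills all terms of \<open>associator_deform\<close> but the last two.\<close>

lemma assoc_deform_iff:
  assumes "assoc_conformal_algebra scale D circ"
  shows "assoc_conformal_algebra (hscale scale) (hD D) (deform circ \<mu>) \<longleftrightarrow>
    (\<forall>a b c. associator scale circ \<mu> a b c + associator scale \<mu> circ a b c = 0)"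
proof -
  have assoc: "associator scale circ circ a b c = 0" for a b c
    using assms by (simp add: assoc_conformal_algebra_iff_associator)
  have split: "v = 0 \<longleftrightarrow> Poly_Mapping.map fst v = 0 \<and> Poly_Mapping.map snd v = 0" for v :: "('a \<times> 'a) lpoly"
    by (auto simp: poly_mapping_eq_iff fun_eq_iff lookup_map_zero prod_eq_iff)
  show ?thesis
    by (auto simp: assoc_conformal_algebra_iff_associator conformal_algebra_deform split associator_deform assoc)
qed

text \<open>The first and the last term of the differential are the double products with \<open>\<circ>\<close> outside. The
  two middle terms are those with \<open>\<mu>\<close> outside; merging the variables makes \<open>\<lambda>\<^sub>0 + \<lambda>\<^sub>1\<close> the argument
  of \<open>\<mu>\<close> when \<open>a \<circ> b\<close> is inserted and leaves \<open>\<lambda>\<^sub>0\<close> when \<open>b \<circ> c\<close> is inserted.\<close>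

lemma hoch_d_2_bracket_of:
  "hoch_d scale circ 2 (bracket_of scale \<mu>) [a, b, c] = associator scale circ \<mu> a b c + associator scale \<mu> circ a b c"
  by (simp add: hoch_d_def bracket_of_def associator_def numeral_2_eq_2 lessThan_Suc Let_def
      subst_lpoly_subst_poly merge_vars_def prod_at_lconst mu.prod_at_lconst
      mu.prod_at_lconst_subst mu.prod_at_subst_lconst algebra_simps)

end

section \<open>Brackets of two arguments\<close>

lemma all_lists_length_2: "(\<forall>xs. length xs = 2 \<longrightarrow> P xs) \<longleftrightarrow> (\<forall>a b. P [a, b])"
  by (auto simp: length_Suc_conv numeral_2_eq_2)

lemma all_lists_length_1: "(\<forall>xs. length xs = 1 \<longrightarrow> P xs) \<longleftrightarrow> (\<forall>a. P [a])"
  by (auto simp: length_Suc_conv)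

context complex_vector_space
begin

lemma linear_subst_poly_iff:
  "Vector_Spaces.linear s (\<lambda>c. Poly_Mapping.map (s c)) (\<lambda>a. subst_poly s (lam i) (f a)) \<longleftrightarrow>
    Vector_Spaces.linear s (\<lambda>c. map_poly (s c)) f"
proof -
  have "Poly_Mapping.map (s c) (subst_poly s (lam i) p) = subst_poly s (lam i) (map_poly (s c) p)" for c p
    by (rule subst_poly_map[OF linear_scale_self])
  then show ?thesis
    by (simp add: Vector_Spaces.linear_iff vector_space_map_poly vector_space_map_lpoly vector_space_axioms
        subst_poly_add[symmetric] inj_eq[OF inj_subst_poly_lam])
qed

text \<open>The substitution \<open>\<lambda> \<mapsto> \<lambda>\<^sub>0\<close> is injective and commutes with the scalars, with \<open>\<partial>\<close> and with
  multiplication by the variable, so each condition on a bracket is equivalent to the corresponding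
  axiom for \<open>\<mu>\<close>.\<close>

lemma bracket_of_in_brackets_iff:
  assumes D: "Vector_Spaces.linear s s D"
  shows "bracket_of s \<mu> \<in> brackets s D 2 \<longleftrightarrow> conformal_algebra s D \<mu>"
proof -
  have keys: "Poly_Mapping.keys m \<subseteq> {..<1}" if "m \<in> Poly_Mapping.keys (subst_poly s (lam 0) p)" for m p
    using that keys_subst_poly_lam[of 0 p] by (auto split: if_splits)
  have left: "- lscale s (lam 0) (subst_poly s (lam 0) p) = subst_poly s (lam 0) (- pCons 0 p)" for p
    by (simp add: subst_poly_lam_shift additive.minus[OF additive_subst_poly] additive.minus[OF additive_lscale])
  have right: "lscale s (lam 0) (subst_poly s (lam 0) p) + Poly_Mapping.map D (subst_poly s (lam 0) p) =
      subst_poly s (lam 0) (map_poly D p + pCons 0 p)" for p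
    by (simp add: subst_poly_lam_shift subst_poly_add subst_poly_map[OF D])
  have less_2: "(\<forall>i<2. P i) \<longleftrightarrow> P 0 \<and> P (Suc 0)" for P :: "nat \<Rightarrow> bool"
    by (auto simp: numeral_2_eq_2 less_Suc_eq)
  have "bracket_of s \<mu> \<in> brackets s D 2 \<longleftrightarrow>
     (\<forall>a b. Vector_Spaces.linear s (\<lambda>c. map_poly (s c)) (\<lambda>a. \<mu> a b) \<and>
       Vector_Spaces.linear s (\<lambda>c. map_poly (s c)) (\<mu> a) \<and>
       \<mu> (D a) b = - pCons 0 (\<mu> a b) \<and> \<mu> a (D b) = map_poly D (\<mu> a b) + pCons 0 (\<mu> a b))"
    unfolding brackets_def mem_Collect_eq all_lists_length_2 less_2
    using keys
    by (simp add: bracket_of_def linear_subst_poly_iff left right inj_eq[OF inj_subst_poly_lam])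
  also have "\<dots> \<longleftrightarrow> conformal_algebra s D \<mu>"
    using vector_space_axioms D by (auto simp: conformal_algebra_def conformal_algebra_axioms_def)
  finally show ?thesis .
qed

lemma bracket_of_surj:
  assumes "\<gamma> \<in> brackets s D 2"
  obtains \<mu> where "bracket_of s \<mu> = \<gamma>"
proof -
  have "\<exists>p. subst_poly s (lam 0) p = \<gamma> [a, b]" for a b
    using assms by (intro univariate_lpoly_is_subst) (auto simp: brackets_def all_lists_length_2 lessThan_Suc)
  then obtain \<mu> where "subst_poly s (lam 0) (\<mu> a b) = \<gamma> [a, b]" for a b
    by metis
  then have "bracket_of s \<mu> = \<gamma>"
    using assms by (auto simp: bracket_of_def brackets_def fun_eq_iff numeral_2_eq_2 length_Suc_conv)
  then show ?thesis by (rule that)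
qed

lemma inj_bracket_of: "inj (bracket_of s)"
proof (intro injI ext)
  fix \<mu> \<mu>' :: "'a \<Rightarrow> 'a \<Rightarrow> 'a poly" and a b
  assume "bracket_of s \<mu> = bracket_of s \<mu>'"
  from fun_cong[OF this, of "[a, b]"] show "\<mu> a b = \<mu>' a b"
    by (simp add: bracket_of_def inj_eq[OF inj_subst_poly_lam])
qed

text \<open>A bracket of one argument has no variables at all, so its values are constants; the condition on
  its last slot then says that it commutes with \<open>\<partial>\<close>.\<close>

lemma brackets_1_iff:
  assumes D: "Vector_Spaces.linear s s D"
  shows "\<gamma> \<in> brackets s D 1 \<longleftrightarrow> (\<exists>\<phi>. Vector_Spaces.linear s s \<phi> \<and> (\<forall>a. \<phi> (D a) = D (\<phi> a)) \<and>
    \<gamma> = (\<lambda>xs. if length xs = 1 then lconst (\<phi> (hd xs)) else 0))" (is "?L \<longleftrightarrow> ?R")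
proof -
  have keys_lconst: "m \<in> Poly_Mapping.keys (lconst x) \<Longrightarrow> m = 0" for m and x :: 'a
    by (simp add: lconst_def split: if_splits)
  have lconst_eq: "lconst x = lconst y \<longleftrightarrow> x = y" for x y :: 'a
    by (simp add: lconst_def inj_eq[OF inj_single])
  have linear: "Vector_Spaces.linear s (\<lambda>c. Poly_Mapping.map (s c)) (\<lambda>a. lconst (\<phi> a)) \<longleftrightarrow>
      Vector_Spaces.linear s s \<phi>" for \<phi>
    by (simp add: Vector_Spaces.linear_iff vector_space_axioms vector_space_map_lpoly lconst_def
        single_add[symmetric] map_single inj_eq[OF inj_single])
  have map_D: "Poly_Mapping.map D (lconst x) = lconst (D x)" for x
    by (simp add: lconst_def map_single linear_zero[OF D])
  have char: "(\<lambda>xs. if length xs = 1 then lconst (\<phi> (hd xs)) else 0) \<in> brackets s D 1 \<longleftrightarrow>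
      Vector_Spaces.linear s s \<phi> \<and> (\<forall>a. \<phi> (D a) = D (\<phi> a))" for \<phi>
    unfolding brackets_def mem_Collect_eq all_lists_length_1
    by (auto simp: lconst_eq linear map_D keys_lconst)
  show ?thesis
  proof
    assume \<gamma>: ?L
    define \<phi> where "\<phi> a = Poly_Mapping.lookup (\<gamma> [a]) 0" for a
    have "\<gamma> [a] = lconst (\<phi> a)" for a
    proof -
      have "Poly_Mapping.keys (\<gamma> [a]) \<subseteq> {0}"
        using \<gamma> unfolding brackets_def mem_Collect_eq all_lists_length_1 by auto
      then show ?thesis
        by (intro poly_mapping_eqI) (auto simp: \<phi>_def lconst_def lookup_single when_def in_keys_iff subset_iff)
    qed
    then have "\<gamma> = (\<lambda>xs. if length xs = 1 then lconst (\<phi> (hd xs)) else 0)"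
      using \<gamma> by (auto simp: brackets_def fun_eq_iff length_Suc_conv)
    then show ?R
      using \<gamma> char[of \<phi>] by (intro exI[of _ \<phi>]) (simp only: simp_thms)
  next
    assume ?R
    then show ?L by (elim exE conjE) (simp only: char simp_thms)
  qed
qed

end

context conformal_algebra
begin

text \<open>The values of \<open>\<phi>\<close> are constants, on which changes of variables act trivially; the variable
  \<open>\<lambda>\<^sub>0\<close> enters only through the product \<open>\<circ>\<close>.\<close>

lemma hoch_d_1:
  assumes \<phi>: "Vector_Spaces.linear scale scale \<phi>"
  shows "hoch_d scale circ 1 (\<lambda>xs. if length xs = 1 then lconst (\<phi> (hd xs)) else 0) =
    bracket_of scale (\<lambda>a b. circ a (\<phi> b) - map_poly \<phi> (circ a b) + circ (\<phi> a) b)"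
proof
  fix xs :: "'a list"
  have sum: "(\<Sum>k\<le>degree p. lscale scale (lam 0 ^ k) (lconst (\<phi> (coeff p k)))) =
      subst_poly scale (lam 0) (map_poly \<phi> p)" for p
    by (subst subst_poly_map[OF \<phi>, symmetric]) (simp add: subst_poly_def
        additive.sum[OF additive_lpoly_map[OF linear_additive[OF \<phi>]]] lscale_map[OF \<phi>]
        lconst_def map_single linear_zero[OF \<phi>])
  show "hoch_d scale circ 1 (\<lambda>xs. if length xs = 1 then lconst (\<phi> (hd xs)) else 0) xs =
      bracket_of scale (\<lambda>a b. circ a (\<phi> b) - map_poly \<phi> (circ a b) + circ (\<phi> a) b) xs"
  proof (cases "length xs = 2")
    case True
    then obtain a b where "xs = [a, b]"
      by (auto simp: length_Suc_conv numeral_2_eq_2)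
    then show ?thesis
      by (simp add: hoch_d_def bracket_of_def Let_def subst_lpoly_lconst prod_at_lconst sum
          subst_poly_add additive.diff[OF additive_subst_poly] power2_eq_square)
  qed (simp add: hoch_d_def bracket_of_def)
qed

lemma bracket_diff_coboundary_iff:
  "(\<lambda>xs. bracket_of scale \<mu> xs - bracket_of scale \<mu>' xs) \<in> coboundaries scale D circ 2 \<longleftrightarrow>
    (\<exists>\<phi>. Vector_Spaces.linear scale scale \<phi> \<and> (\<forall>a. \<phi> (D a) = D (\<phi> a)) \<and>
      (\<forall>a b. \<mu> a b - \<mu>' a b = circ a (\<phi> b) - map_poly \<phi> (circ a b) + circ (\<phi> a) b))"
proof -
  have diff: "(\<lambda>xs. bracket_of scale \<mu> xs - bracket_of scale \<mu>' xs) =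
      bracket_of scale (\<lambda>a b. \<mu> a b - \<mu>' a b)"
    by (auto simp: bracket_of_def additive.diff[OF additive_subst_poly])
  have "(\<lambda>xs. bracket_of scale \<mu> xs - bracket_of scale \<mu>' xs) \<in> coboundaries scale D circ 2 \<longleftrightarrow>
      (\<exists>\<gamma>. \<gamma> \<in> brackets scale D 1 \<and> bracket_of scale (\<lambda>a b. \<mu> a b - \<mu>' a b) = hoch_d scale circ 1 \<gamma>)"
    unfolding diff by (auto simp: coboundaries_def)
  also have "\<dots> \<longleftrightarrow> (\<exists>\<phi>. Vector_Spaces.linear scale scale \<phi> \<and> (\<forall>a. \<phi> (D a) = D (\<phi> a)) \<and>
      bracket_of scale (\<lambda>a b. \<mu> a b - \<mu>' a b) =
      hoch_d scale circ 1 (\<lambda>xs. if length xs = 1 then lconst (\<phi> (hd xs)) else 0))"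
    unfolding brackets_1_iff[OF D_linear] by blast
  also have "\<dots> \<longleftrightarrow> (\<exists>\<phi>. Vector_Spaces.linear scale scale \<phi> \<and> (\<forall>a. \<phi> (D a) = D (\<phi> a)) \<and>
      (\<forall>a b. \<mu> a b - \<mu>' a b = circ a (\<phi> b) - map_poly \<phi> (circ a b) + circ (\<phi> a) b))"
    by (intro arg_cong[where f = Ex] ext conj_cong refl)
      (simp only: hoch_d_1 inj_eq[OF inj_bracket_of], simp add: fun_eq_iff)
  finally show ?thesis .
qed

text \<open>The coefficient of 1 in the homomorphism condition is trivial. In the coefficient of \<open>\<hbar>\<close> the
  contributions of the \<open>\<hbar>\<close>-parts of the two arguments cancel by additivity of \<open>\<circ>\<close>, which leaves a
  condition on their constant parts.\<close>

lemma conformal_hom_deform_iff: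
  assumes \<phi>: "Vector_Spaces.linear scale scale \<phi>" and \<phi>_D: "\<forall>a. \<phi> (D a) = D (\<phi> a)"
  shows "conformal_hom (hscale scale) (hD D) (deform circ \<mu>) (hscale scale) (hD D) (deform circ \<mu>')
      (\<lambda>(a, b). (a, \<phi> a + b)) \<longleftrightarrow>
    (\<forall>a b. \<mu> a b - \<mu>' a b = circ a (\<phi> b) - map_poly \<phi> (circ a b) + circ (\<phi> a) b)"
    (is "conformal_hom _ _ _ _ _ _ ?f \<longleftrightarrow> ?R")
proof -
  have rearrange: "p + (x + y + m) = (u + x) + (v + y) + m' \<longleftrightarrow> m - m' = u - p + v" for p x y m u v m' :: 'a
  proof -
    have "p + (x + y + m) - ((u + x) + (v + y) + m') = m - m' - (u - p + v)"
      by simp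
    then show ?thesis
      by (simp only: eq_iff_diff_eq_0[of "p + (x + y + m)"] eq_iff_diff_eq_0[of "m - m'"])
  qed
  have hom_at: "map_poly ?f (deform circ \<mu> x y) = deform circ \<mu>' (?f x) (?f y) \<longleftrightarrow>
      \<mu> (fst x) (fst y) - \<mu>' (fst x) (fst y) =
      circ (fst x) (\<phi> (fst y)) - map_poly \<phi> (circ (fst x) (fst y)) + circ (\<phi> (fst x)) (fst y)" for x y
    by (simp add: poly_eq_iff coeff_map_poly coeff_deform linear_zero[OF \<phi>] zero_prod_def split_beta
        circ_add rearrange)
  have "Vector_Spaces.linear (hscale scale) (hscale scale) ?f"
    using \<phi> vector_space_hscale[OF vector_space_axioms]
    by (auto simp: Vector_Spaces.linear_iff hscale_def algebra_simps)
  moreover have "?f (hD D x) = hD D (?f x)" for x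
    using D_linear \<phi>_D by (auto simp: Vector_Spaces.linear_iff hD_def split: prod.splits)
  ultimately have "conformal_hom (hscale scale) (hD D) (deform circ \<mu>) (hscale scale) (hD D) (deform circ \<mu>') ?f
      \<longleftrightarrow> (\<forall>x y. map_poly ?f (deform circ \<mu> x y) = deform circ \<mu>' (?f x) (?f y))"
    by (simp add: conformal_hom_def)
  also have "\<dots> \<longleftrightarrow> ?R"
    unfolding hom_at
  proof (intro iffI allI)
    fix a b
    assume *: "\<forall>(x :: 'a \<times> 'a) (y :: 'a \<times> 'a). \<mu> (fst x) (fst y) - \<mu>' (fst x) (fst y) =
      circ (fst x) (\<phi> (fst y)) - map_poly \<phi> (circ (fst x) (fst y)) + circ (\<phi> (fst x)) (fst y)"
    show "\<mu> a b - \<mu>' a b = circ a (\<phi> b) - map_poly \<phi> (circ a b) + circ (\<phi> a) b"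
      by (rule *[rule_format, of "(a, 0)" "(b, 0)", unfolded fst_conv])
  qed blast
  finally show ?thesis .
qed

end

section \<open>Deformations are cocycles\<close>

context assoc_conformal_algebra
begin

lemma cocycle_iff_deformation:
  "bracket_of scale \<mu> \<in> cocycles scale D circ 2 \<longleftrightarrow> \<mu> \<in> inf_deformations scale D circ"
proof (cases "conformal_algebra scale D \<mu>")
  case True
  interpret conformal_algebra_pair scale D circ \<mu>
    using True by (simp add: conformal_algebra_pair_def conformal_algebra_axioms)
  have "hoch_d scale circ 2 (bracket_of scale \<mu>) = (\<lambda>_. 0) \<longleftrightarrow>
      (\<forall>a b c. hoch_d scale circ 2 (bracket_of scale \<mu>) [a, b, c] = 0)"
  proof (intro iffI ext)
    fix xs :: "'a list"
    assume *: "\<forall>a b c. hoch_d scale circ 2 (bracket_of scale \<mu>) [a, b, c] = 0"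
    show "hoch_d scale circ 2 (bracket_of scale \<mu>) xs = 0"
    proof (cases "length xs = 3")
      case True
      then obtain a b c where "xs = [a, b, c]"
        by (auto simp: length_Suc_conv numeral_3_eq_3)
      with * show ?thesis by blast
    qed (simp add: hoch_d_def)
  qed simp
  then show ?thesis
    using True
    by (simp add: cocycles_def inf_deformations_def bracket_of_in_brackets_iff[OF D_linear]
        assoc_deform_iff[OF assoc_conformal_algebra_axioms] hoch_d_2_bracket_of)
qed (simp add: cocycles_def inf_deformations_def bracket_of_in_brackets_iff[OF D_linear])

lemma bij_betw_deformations_cocycles:
  "bij_betw (bracket_of scale) (inf_deformations scale D circ) (cocycles scale D circ 2)"
proof (rule bij_betw_imageI)
  show "inj_on (bracket_of scale) (inf_deformations scale D circ)"
    using inj_bracket_of by (rule inj_on_subset) simp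
  show "bracket_of scale ` inf_deformations scale D circ = cocycles scale D circ 2"
  proof (intro subset_antisym subsetI)
    fix \<gamma> assume \<gamma>: "\<gamma> \<in> cocycles scale D circ 2"
    then obtain \<mu> where "bracket_of scale \<mu> = \<gamma>"
      using bracket_of_surj by (auto simp: cocycles_def)
    with \<gamma> show "\<gamma> \<in> bracket_of scale ` inf_deformations scale D circ"
      by (auto simp: cocycle_iff_deformation[symmetric])
  qed (auto simp: cocycle_iff_deformation)
qed

lemma equiv_deformations_iff_cohomologous:
  "(\<mu>, \<mu>') \<in> equiv_deformations scale D circ \<longleftrightarrow>
    (bracket_of scale \<mu>, bracket_of scale \<mu>') \<in> cohomologous scale D circ 2"
proof -
  have "(\<exists>\<phi>. Vector_Spaces.linear scale scale \<phi> \<and> (\<forall>a. \<phi> (D a) = D (\<phi> a)) \<and>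
      conformal_hom (hscale scale) (hD D) (deform circ \<mu>) (hscale scale) (hD D) (deform circ \<mu>')
        (\<lambda>(a, b). (a, \<phi> a + b))) \<longleftrightarrow>
    (\<lambda>xs. bracket_of scale \<mu> xs - bracket_of scale \<mu>' xs) \<in> coboundaries scale D circ 2"
    unfolding bracket_diff_coboundary_iff
    by (intro arg_cong[where f = Ex] ext conj_cong refl) (rule conformal_hom_deform_iff)
  then show ?thesis
    unfolding equiv_deformations_def cohomologous_def mem_Collect_eq prod.case cocycle_iff_deformation
    by blast
qed

end

text \<open>A bijection that preserves and reflects a relation carries the image of each element under one
  relation onto the image under the other, so it induces a bijection of quotients by direct image.\<close>

lemma bij_betw_quotient_image:
  assumes f: "bij_betw f S T" and R: "R \<subseteq> S \<times> S" and R': "R' \<subseteq> T \<times> T"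
    and rel: "\<And>x y. (x, y) \<in> R \<longleftrightarrow> (f x, f y) \<in> R'"
  shows "bij_betw ((`) f) (S // R) (T // R')" and "\<And>x. f ` (R `` {x}) = R' `` {f x}"
proof -
  show im: "f ` (R `` {x}) = R' `` {f x}" for x
  proof (intro subset_antisym subsetI)
    fix y assume "y \<in> R' `` {f x}"
    moreover from this obtain z where "y = f z"
      using R' f by (auto simp: bij_betw_def)
    ultimately show "y \<in> f ` (R `` {x})"
      using rel by auto
  qed (use rel in auto)
  show "bij_betw ((`) f) (S // R) (T // R')"
  proof (rule bij_betw_imageI)
    have "S // R \<subseteq> Pow S"
      using R by (auto simp: quotient_def)
    then show "inj_on ((`) f) (S // R)"
      using f by (meson bij_betw_def inj_on_image_Pow inj_on_subset)
    have "S // R = (\<lambda>x. R `` {x}) ` S" "T // R' = (\<lambda>x. R' `` {f x}) ` S"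
      using f by (auto simp: quotient_def bij_betw_def)
    then show "(`) f ` (S // R) = T // R'"
      by (simp add: image_image im)
  qed
qed

theorem theorem4p10:
  fixes scale :: "complex \<Rightarrow> 'a::ab_group_add \<Rightarrow> 'a"
    and D :: "'a \<Rightarrow> 'a"
    and circ :: "'a \<Rightarrow> 'a \<Rightarrow> 'a poly"
  assumes "comm_assoc_conformal_algebra scale D circ"
  shows "\<exists>F. bij_betw F
      (inf_deformations scale D circ // equiv_deformations scale D circ)
      (cohomology scale D circ 2) \<and>
    (\<forall>\<mu>\<in>inf_deformations scale D circ.
      F (equiv_deformations scale D circ `` {\<mu>}) =
        cohomology_class scale D circ 2 (bracket_of scale \<mu>))"
proof -
  interpret assoc_conformal_algebra scale D circ
    using assms by (simp add: comm_assoc_conformal_algebra_def)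
  have "equiv_deformations scale D circ \<subseteq> inf_deformations scale D circ \<times> inf_deformations scale D circ"
    and "cohomologous scale D circ 2 \<subseteq> cocycles scale D circ 2 \<times> cocycles scale D circ 2"
    by (auto simp: equiv_deformations_def cohomologous_def)
  note quotient = bij_betw_quotient_image[OF bij_betw_deformations_cocycles this equiv_deformations_iff_cohomologous]
  show ?thesis
    unfolding cohomology_def cohomology_class_def using quotient by blast
qed

end
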